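(* Let $X$ be a real Banach space with a normalized Schauder basis $(e_n)_{n\in\mathbb N}$ and let $w=(w_n)$ be a weight sequence. Then the following assertions are equivalent: (a) $(e_n)$ is $w$-partially greedy. (b) $(e_n)$ is quasi-greedy and $w$-conservative.
   Context: Let $(e_n^* )$ be the biorthogonal functionals of $(e_n)$. A weight sequence $w=(w_n)_{n\in\mathbb N}$ is a sequence of positive real numbers; $w(A)=\sum_{i\in A}w_i$ for $A\subset\mathbb N$. $\mathbb N^{<\infty}$ is the set of all finite subsets of $\mathbb N$ (including $\emptyset$). $1_A=\sum_{i\in A}e_i$ and $P_A(x)=\sum_{i\in A}e_i^*(x)e_i$ for $A\in\mathbb N^{<\infty}$. $A<B$ means that every element of $A$ is smaller than every element of $B$ (so it holds if $A$ or $B$ is empty); for $n\in\mathbb N$, $A<n$ means $A<\{n\}$. For $x\in X$ and $m\in\mathbb N$, $\Lambda_m(x)$ denotes any set of $m$ indices with $\min_{n\in\Lambda_m(x)}|e_n^*(x)|\ge\max_{n\notin\Lambda_m(x)}|e_n^*(x)|$; the corresponding $m$-th greedy approximant is $G_m(x)=\sum_{n\in\Lambda_m(x)}e_n^*(x)e_n$, and $\alpha_m(x)=\min\Lambda_m(x)$. Conditions involving $G_m(x)$ are required for every admissible choice of $\Lambda_m(x)$. $(e_n)$ is quasi-greedy if there is a constant $C$ such that $\|G_m(x)\|\le C\|x\|$ for all $x\in X$, $m\in\mathbb N$. $(e_n)$ is $w$-partially greedy if there is a constant $C$ such that for all $x\in X$, $m\in\mathbb N$, $$\|x-G_m(x)\|\le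 C\inf\{\|x-P_A(x)\|: A\in\mathbb N^{<\infty},\ w(A)\le w(\Lambda_m(x)),\ A<\alpha_m(x)\}.$$ $(e_n)$ is $w$-conservative if there is a constant $C\ge1$ such that $\|1_A\|\le C\|1_B\|$ whenever $A,B\in\mathbb N^{<\infty}$, $A<B$ and $w(A)\le w(B)$. *)

theory Defs
  imports "HOL-Analysis.Analysis"
begin

definition schauder_basis :: "(nat \<Rightarrow> 'a::real_normed_vector) \<Rightarrow> bool" where
  "schauder_basis e \<longleftrightarrow> (\<forall>x. \<exists>!a :: nat \<Rightarrow> real. (\<lambda>n. a n *\<^sub>R e n) sums x)"

(* The biorthogonal functionals of a Schauder basis are its coordinate functionals:
   dual_fun e n x is the n-th coefficient of the expansion of x in e. It is only
   meaningful when e is a Schauder basis. *)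
definition dual_fun :: "(nat \<Rightarrow> 'a::real_normed_vector) \<Rightarrow> nat \<Rightarrow> 'a \<Rightarrow> real" where
  "dual_fun e n x = (THE a :: nat \<Rightarrow> real. (\<lambda>k. a k *\<^sub>R e k) sums x) n"

lemma dual_fun_sums:
  assumes "schauder_basis e"
  shows "(\<lambda>n. dual_fun e n x *\<^sub>R e n) sums x"
proof -
  define P where "P = (\<lambda>a :: nat \<Rightarrow> real. (\<lambda>k. a k *\<^sub>R e k) sums x)"
  have "\<exists>!a. P a"
    using assms unfolding schauder_basis_def P_def by (rule spec)
  then have "P (The P)" by (rule theI')
  then show ?thesis by (simp add: P_def dual_fun_def)
qed

lemma dual_fun_unique:
  assumes "schauder_basis e" "(\<lambda>n. a n *\<^sub>R e n) sums x"
  shows "dual_fun e n x = a n"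
proof -
  define P where "P = (\<lambda>a :: nat \<Rightarrow> real. (\<lambda>k. a k *\<^sub>R e k) sums x)"
  have "\<exists>!a. P a"
    using assms(1) unfolding schauder_basis_def P_def by (rule spec)
  moreover have "P a" using assms(2) by (simp add: P_def)
  ultimately have "The P = a" by (rule the1_equality[of P a])
  then show ?thesis by (simp add: P_def dual_fun_def)
qed

lemma dual_fun_biorthogonal:
  assumes "schauder_basis e"
  shows "dual_fun e m (e n) = (if m = n then 1 else 0)"
proof (rule dual_fun_unique[OF assms])
  have "(\<lambda>k. if k = n then e k else 0) sums e n"
    by (rule sums_single)
  moreover have "(\<lambda>k. (if k = n then 1 else 0) *\<^sub>R e k) = (\<lambda>k. if k = n then e k else 0)"
    by auto
  ultimately show "(\<lambda>k. (if k = n then 1 else 0) *\<^sub>R e k) sums e n" by simp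
qed

definition weight_sequence :: "(nat \<Rightarrow> real) \<Rightarrow> bool" where
  "weight_sequence w \<longleftrightarrow> (\<forall>n. 0 < w n)"

definition weight :: "(nat \<Rightarrow> real) \<Rightarrow> nat set \<Rightarrow> real" where
  "weight w A = (\<Sum>i\<in>A. w i)"

definition set_less :: "nat set \<Rightarrow> nat set \<Rightarrow> bool" where
  "set_less A B \<longleftrightarrow> (\<forall>a\<in>A. \<forall>b\<in>B. a < b)"

definition ind_vec :: "(nat \<Rightarrow> 'a::real_normed_vector) \<Rightarrow> nat set \<Rightarrow> 'a" where
  "ind_vec e A = (\<Sum>i\<in>A. e i)"

definition basis_proj :: "(nat \<Rightarrow> 'a::real_normed_vector) \<Rightarrow> nat set \<Rightarrow> 'a \<Rightarrow> 'a" where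
  "basis_proj e A x = (\<Sum>i\<in>A. dual_fun e i x *\<^sub>R e i)"

(* L is an admissible choice of the index set of the m-th greedy approximant of x.
   That approximant, for the choice L, is basis_proj e L x. *)
definition greedy_set :: "(nat \<Rightarrow> 'a::real_normed_vector) \<Rightarrow> 'a \<Rightarrow> nat \<Rightarrow> nat set \<Rightarrow> bool" where
  "greedy_set e x m L \<longleftrightarrow> finite L \<and> card L = m \<and>
     (\<forall>n\<in>L. \<forall>k. k \<notin> L \<longrightarrow> \<bar>dual_fun e k x\<bar> \<le> \<bar>dual_fun e n x\<bar>)"

definition quasi_greedy :: "(nat \<Rightarrow> 'a::real_normed_vector) \<Rightarrow> bool" where
  "quasi_greedy e \<longleftrightarrow> (\<exists>C::real. \<forall>x m L. 1 \<le> m \<longrightarrow> greedy_set e x m L \<longrightarrow>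
     norm (basis_proj e L x) \<le> C * norm x)"

(* m starts at 1, so L is nonempty and Min L is defined. The infimum is over a set of
   nonnegative reals that is nonempty, since A = {} is always allowed. *)
definition w_partially_greedy :: "(nat \<Rightarrow> real) \<Rightarrow> (nat \<Rightarrow> 'a::real_normed_vector) \<Rightarrow> bool" where
  "w_partially_greedy w e \<longleftrightarrow> (\<exists>C::real. \<forall>x m L. 1 \<le> m \<longrightarrow> greedy_set e x m L \<longrightarrow>
     norm (x - basis_proj e L x)
       \<le> C * (INF A\<in>{A. finite A \<and> weight w A \<le> weight w L \<and> set_less A {Min L}}.
                norm (x - basis_proj e A x)))"

definition w_conservative :: "(nat \<Rightarrow> real) \<Rightarrow> (nat \<Rightarrow> 'a::real_normed_vector) \<Rightarrow> bool" where
  "w_conservative w e \<longleftrightarrow> (\<exists>C::real. 1 \<le> C \<and> (\<forall>A B. finite A \<longrightarrow> finite B \<longrightarrow>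
     set_less A B \<longrightarrow> weight w A \<le> weight w B \<longrightarrow>
     norm (ind_vec e A) \<le> C * norm (ind_vec e B)))"

end

(* The forward direction tests partial greediness on A = {} and on 1_A + 1_B, for which B is a greedy
   set. Conversely, let L be greedy for x, let A < L with w(A) <= w(L), put z = x - P_A x and let alpha
   be the least modulus of a coefficient of x on L. Then L is greedy for z and
   x - P_L x = (z - P_L z) + P_A x, so only P_A x has to be bounded. The coefficients of x on A are at
   most alpha in modulus, so by convexity and conservativeness its norm is at most a multiple of
   alpha |1_L|; Abel summation over the greedy subsets of L bounds this by a multiple of |z|. *)
theory Submission
  imports Defs
begin

section \<open>Abel summation and convexity\<close>

text \<open>Abel summation along the decreasing rearrangement of \<open>d\<close>: the sum is \<open>t - s\<close> times a convex
  combination of 0 and sums over superlevel sets. Allowing every set \<open>U\<close> compatible with the order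
  makes the same statement cover both convexity and greedy sums.\<close>
lemma norm_sum_superlevel_le:
  fixes v :: "'b \<Rightarrow> 'a::real_normed_vector" and d :: "'b \<Rightarrow> real"
  assumes "finite S" and "\<And>i. i \<in> S \<Longrightarrow> s \<le> d i \<and> d i \<le> t" and "s \<le> t"
    and "\<And>U. U \<subseteq> S \<Longrightarrow> (\<And>i k. i \<in> U \<Longrightarrow> k \<in> S - U \<Longrightarrow> d k \<le> d i) \<Longrightarrow> norm (sum v U) \<le> M"
  shows "norm (\<Sum>i\<in>S. (d i - s) *\<^sub>R v i) \<le> (t - s) * M"
  using assms
\<comment> \<open>Ranking by \<open>- d\<close> makes the inserted \<open>x\<close> a minimiser of
  \<open>d\<close>. The layer of height \<open>d x - s\<close> over the whole set is split off, and
  the rest is the same claim with \<open>d x\<close> in place of \<open>s\<close>.\<close>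
proof (induction S arbitrary: s rule: finite_ranking_induct[where f = "\<lambda>i. - d i"])
  case empty
  have "0 \<le> M" using empty.prems(3)[of "{}"] by simp
  then show ?case using empty.prems(2) by simp
next
  case (insert x S)
  have min: "d x \<le> d y" if "y \<in> S" for y using insert.hyps(2)[OF that] by simp
  show ?case
  proof (cases "x \<in> S")
    case True
    then show ?thesis
      using insert.IH[of s] insert.prems by (simp add: insert_absorb)
  next
    case False
    have x: "s \<le> d x" "d x \<le> t" using insert.prems(1) by auto
    have IH: "norm (\<Sum>i\<in>S. (d i - d x) *\<^sub>R v i) \<le> (t - d x) * M"
    proof (rule insert.IH)
      \<comment> \<open>Since \<open>d x\<close> is minimal, a set compatible with the order on
        \<open>S\<close> stays compatible on \<open>insert x S\<close>.\<close>
      fix U assume U: "U \<subseteq> S" "\<And>i k. i \<in> U \<Longrightarrow> k \<in> S - U \<Longrightarrow> d k \<le> d i"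
      show "norm (sum v U) \<le> M"
        by (rule insert.prems(3)) (use U min in auto)
    qed (use insert.prems(1) min x in auto)
    have "norm (sum v (insert x S)) \<le> M"
      by (rule insert.prems(3)) auto
    then have all: "norm ((d x - s) *\<^sub>R sum v (insert x S)) \<le> (d x - s) * M"
      using x by (simp add: mult_left_mono)
    have "(\<Sum>i\<in>insert x S. (d i - s) *\<^sub>R v i)
        = (d x - s) *\<^sub>R sum v (insert x S) + (\<Sum>i\<in>insert x S. (d i - d x) *\<^sub>R v i)"
      by (simp only: scaleR_sum_right sum.distrib[symmetric] scaleR_add_left[symmetric]) simp
    also have "(\<Sum>i\<in>insert x S. (d i - d x) *\<^sub>R v i) = (\<Sum>i\<in>S. (d i - d x) *\<^sub>R v i)"
      using False insert.hyps(1) by simp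
    finally have "norm (\<Sum>i\<in>insert x S. (d i - s) *\<^sub>R v i) \<le> (d x - s) * M + (t - d x) * M"
      using norm_add_rule_thm[OF all IH] by simp
    then show ?thesis by (simp add: algebra_simps)
  qed
qed

text \<open>The positive and the negative parts of the coefficients lie between 0 and
  \<open>r\<close>, so each of the two sums lies in \<open>r\<close> times the convex hull of the
  subset sums; hence the factor 2.\<close>

lemma norm_sum_bounded_coeffs_le:
  fixes v :: "'b \<Rightarrow> 'a::real_normed_vector" and a :: "'b \<Rightarrow> real"
  assumes "finite A" and "\<And>i. i \<in> A \<Longrightarrow> \<bar>a i\<bar> \<le> r" and "0 \<le> r"
    and "\<And>D. D \<subseteq> A \<Longrightarrow> norm (sum v D) \<le> M"
  shows "norm (\<Sum>i\<in>A. a i *\<^sub>R v i) \<le> 2 * (r * M)"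
proof -
  have part: "norm (\<Sum>i\<in>A. (max (b i) 0 - 0) *\<^sub>R v i) \<le> (r - 0) * M"
    if "\<And>i. i \<in> A \<Longrightarrow> b i \<le> r" for b
    by (rule norm_sum_superlevel_le) (use assms that in auto)
  have "norm (\<Sum>i\<in>A. max (a i) 0 *\<^sub>R v i) \<le> r * M"
    using part[of a] assms(2) by force
  moreover have "norm (\<Sum>i\<in>A. max (- a i) 0 *\<^sub>R v i) \<le> r * M"
    using part[of "\<lambda>i. - a i"] assms(2) by force
  moreover have "(\<Sum>i\<in>A. a i *\<^sub>R v i)
      = (\<Sum>i\<in>A. max (a i) 0 *\<^sub>R v i) - (\<Sum>i\<in>A. max (- a i) 0 *\<^sub>R v i)"
    unfolding sum_subtractf[symmetric] scaleR_diff_left[symmetric]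
    by (intro sum.cong refl arg_cong2[where f = scaleR]) auto
  ultimately show ?thesis
    using norm_triangle_ineq4[of "\<Sum>i\<in>A. max (a i) 0 *\<^sub>R v i" "\<Sum>i\<in>A. max (- a i) 0 *\<^sub>R v i"]
    by simp
qed

section \<open>Coordinates of differences, finite sums and remainders\<close>

lemma dual_fun_diff:
  assumes "schauder_basis e"
  shows "dual_fun e k (x - y) = dual_fun e k x - dual_fun e k y"
  by (rule dual_fun_unique[OF assms])
    (use sums_diff[OF dual_fun_sums[OF assms, of x] dual_fun_sums[OF assms, of y]]
     in \<open>simp add: scaleR_diff_left\<close>)

lemma dual_fun_sum:
  assumes "schauder_basis e" and "finite A"
  shows "dual_fun e k (\<Sum>i\<in>A. a i *\<^sub>R e i) = (if k \<in> A then a k else 0)"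
proof (rule dual_fun_unique[OF assms(1)])
  have "(\<lambda>i. (if i \<in> A then a i else 0) *\<^sub>R e i) = (\<lambda>i. if i \<in> A then a i *\<^sub>R e i else 0)"
    by auto
  then show "(\<lambda>i. (if i \<in> A then a i else 0) *\<^sub>R e i) sums (\<Sum>i\<in>A. a i *\<^sub>R e i)"
    using sums_If_finite_set[OF assms(2), of "\<lambda>i. a i *\<^sub>R e i"] by simp
qed

lemma dual_fun_ind_vec:
  assumes "schauder_basis e" and "finite A"
  shows "dual_fun e k (ind_vec e A) = (if k \<in> A then 1 else 0)"
  using dual_fun_sum[OF assms, of k "\<lambda>_. 1"] by (simp add: ind_vec_def)

lemma dual_fun_diff_basis_proj:
  assumes "schauder_basis e" and "finite A"
  shows "dual_fun e k (x - basis_proj e A x) = (if k \<in> A then 0 else dual_fun e k x)"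
  by (simp add: basis_proj_def dual_fun_diff[OF assms(1)] dual_fun_sum[OF assms])

section \<open>Consequences of quasi-greediness\<close>

text \<open>The empty set is included because the superlevel sets in Abel summation may be empty; a
  nonnegative constant keeps later estimates monotone.\<close>

lemma quasi_greedyE:
  assumes "quasi_greedy e"
  obtains C where "0 \<le> C"
    and "\<And>x L. greedy_set e x (card L) L \<Longrightarrow> norm (basis_proj e L x) \<le> C * norm x"
proof -
  obtain C where C: "\<And>x m L. 1 \<le> m \<Longrightarrow> greedy_set e x m L \<Longrightarrow>
      norm (basis_proj e L x) \<le> C * norm x"
    using assms unfolding quasi_greedy_def by blast
  show ?thesis
  proof (rule that[of "max C 0"])
    fix x L assume L: "greedy_set e x (card L) L"
    show "norm (basis_proj e L x) \<le> max C 0 * norm x"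
    proof (cases "L = {}")
      case False
      then have "1 \<le> card L"
        using L by (simp add: greedy_set_def Suc_le_eq card_gt_0_iff)
      then have "norm (basis_proj e L x) \<le> C * norm x" using C L by blast
      also have "\<dots> \<le> max C 0 * norm x" by (simp add: mult_right_mono)
      finally show ?thesis .
    qed (simp add: basis_proj_def)
  qed simp
qed

text \<open>All coefficients of the signed sum have modulus 1 on \<open>L\<close> and vanish
  elsewhere, so every subset of \<open>L\<close> is greedy for it. The indices of each sign cost
  \<open>C\<close> once.\<close>

lemma quasi_greedy_norm_ind_vec_le:
  fixes e :: "nat \<Rightarrow> 'a::real_normed_vector"
  assumes "schauder_basis e"
    and C: "\<And>x L. greedy_set e x (card L) L \<Longrightarrow> norm (basis_proj e L x) \<le> C * norm x"
    and "finite L" and eps: "\<And>i. i \<in> L \<Longrightarrow> \<bar>\<epsilon> i\<bar> = (1::real)"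
  shows "norm (ind_vec e L) \<le> 2 * C * norm (\<Sum>i\<in>L. \<epsilon> i *\<^sub>R e i)"
proof -
  define u where "u = (\<Sum>i\<in>L. \<epsilon> i *\<^sub>R e i)"
  have dual_u: "dual_fun e k u = (if k \<in> L then \<epsilon> k else 0)" for k
    unfolding u_def by (rule dual_fun_sum[OF assms(1,3)])
  have part: "norm (\<Sum>i\<in>U. \<epsilon> i *\<^sub>R e i) \<le> C * norm u" if "U \<subseteq> L" for U
  proof -
    have "greedy_set e u (card U) U"
      using that finite_subset[OF that assms(3)] eps
      unfolding greedy_set_def dual_u by (auto simp: subset_iff)
    moreover have "basis_proj e U u = (\<Sum>i\<in>U. \<epsilon> i *\<^sub>R e i)"
      unfolding basis_proj_def dual_u using that by (intro sum.cong) auto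
    ultimately show ?thesis using C by metis
  qed
  let ?P = "{i \<in> L. \<epsilon> i = 1}" and ?N = "{i \<in> L. \<epsilon> i = -1}"
  have "L = ?P \<union> ?N" using eps by (auto simp: abs_eq_iff')
  then have "ind_vec e L = sum e (?P \<union> ?N)" by (simp add: ind_vec_def)
  also have "\<dots> = sum e ?P + sum e ?N"
    by (rule sum.union_disjoint) (use assms(3) in auto)
  also have "sum e ?P = (\<Sum>i\<in>?P. \<epsilon> i *\<^sub>R e i)" by (intro sum.cong) auto
  also have "sum e ?N = - (\<Sum>i\<in>?N. \<epsilon> i *\<^sub>R e i)"
    unfolding sum_negf[symmetric] by (intro sum.cong) auto
  finally have "norm (ind_vec e L) \<le> norm (\<Sum>i\<in>?P. \<epsilon> i *\<^sub>R e i) + norm (\<Sum>i\<in>?N. \<epsilon> i *\<^sub>R e i)"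
    by (simp add: norm_triangle_ineq4)
  then show ?thesis
    using part[of ?P] part[of ?N] by (simp add: u_def)
qed

text \<open>Shrinking the coefficients on \<open>L\<close> to modulus \<open>r\<close> subtracts a
  sum that Abel summation bounds through greedy sums of \<open>z\<close>. This costs
  \<open>2 * C\<close>, and removing the signs costs another \<open>2 * C\<close>.\<close>

lemma quasi_greedy_truncation_le:
  fixes e :: "nat \<Rightarrow> 'a::real_normed_vector"
  assumes "schauder_basis e" and "0 \<le> C"
    and C: "\<And>x L. greedy_set e x (card L) L \<Longrightarrow> norm (basis_proj e L x) \<le> C * norm x"
    and L: "greedy_set e z (card L) L"
    and "0 < r" and r: "\<And>i. i \<in> L \<Longrightarrow> r \<le> \<bar>dual_fun e i z\<bar>"
  shows "r * norm (ind_vec e L) \<le> 4 * C\<^sup>2 * norm z"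
proof -
  have fin: "finite L" using L by (simp add: greedy_set_def)
  define a where "a i = dual_fun e i z" for i
  define \<epsilon> :: "nat \<Rightarrow> real" where "\<epsilon> i = (if 0 \<le> a i then 1 else -1)" for i
  \<comment> \<open>Chosen so that \<open>(1 - d i) * a i\<close> has modulus \<open>r\<close> on
    \<open>L\<close>. It grows with \<bar>\<open>a i\<close>\<bar>, so its superlevel sets collect
    the largest coefficients.\<close>
  define d where "d i = 1 - r / \<bar>a i\<bar>" for i
  have d: "0 \<le> d i \<and> d i \<le> 1" if "i \<in> L" for i
    using r[OF that] \<open>0 < r\<close> by (auto simp: d_def a_def divide_simps)
  have order: "\<bar>a k\<bar> \<le> \<bar>a i\<bar>" if "d k \<le> d i" "i \<in> L" "k \<in> L" for i k
  proof -
    have "0 < \<bar>a i\<bar>" "0 < \<bar>a k\<bar>" using r that(2,3) \<open>0 < r\<close> unfolding a_def by fastforce+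
    moreover have "r / \<bar>a i\<bar> \<le> r / \<bar>a k\<bar>" using that(1) by (simp add: d_def)
    ultimately show ?thesis using \<open>0 < r\<close> by (simp add: divide_simps)
  qed
  \<comment> \<open>A set of largest coefficients within the greedy set \<open>L\<close> is itself
    greedy for \<open>z\<close>.\<close>
  have sub: "norm (\<Sum>i\<in>U. a i *\<^sub>R e i) \<le> C * norm z"
    if "U \<subseteq> L" "\<And>i k. i \<in> U \<Longrightarrow> k \<in> L - U \<Longrightarrow> \<bar>a k\<bar> \<le> \<bar>a i\<bar>" for U
  proof -
    have "greedy_set e z (card U) U"
      using L that finite_subset[OF that(1) fin]
      unfolding greedy_set_def a_def by blast
    then show ?thesis using C unfolding basis_proj_def a_def by blast
  qed
  have dsum: "norm (\<Sum>i\<in>L. (d i - 0) *\<^sub>R (a i *\<^sub>R e i)) \<le> (1 - 0) * (C * norm z)"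
  proof (rule norm_sum_superlevel_le[OF fin])
    fix U assume U: "U \<subseteq> L" "\<And>i k. i \<in> U \<Longrightarrow> k \<in> L - U \<Longrightarrow> d k \<le> d i"
    show "norm (\<Sum>i\<in>U. a i *\<^sub>R e i) \<le> C * norm z"
      by (rule sub) (use U order in auto)
  qed (use d in auto)
  have "r * \<epsilon> i = a i - d i * a i" if "i \<in> L" for i
    using r[OF that] \<open>0 < r\<close> by (auto simp: d_def \<epsilon>_def a_def algebra_simps)
  then have "r *\<^sub>R (\<Sum>i\<in>L. \<epsilon> i *\<^sub>R e i)
      = (\<Sum>i\<in>L. a i *\<^sub>R e i) - (\<Sum>i\<in>L. (d i - 0) *\<^sub>R (a i *\<^sub>R e i))"
    by (simp add: scaleR_sum_right sum_subtractf[symmetric] scaleR_diff_left[symmetric])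
  then have "norm (r *\<^sub>R (\<Sum>i\<in>L. \<epsilon> i *\<^sub>R e i))
      \<le> norm (\<Sum>i\<in>L. a i *\<^sub>R e i) + norm (\<Sum>i\<in>L. (d i - 0) *\<^sub>R (a i *\<^sub>R e i))"
    by (simp only: norm_triangle_ineq4)
  then have signs: "r * norm (\<Sum>i\<in>L. \<epsilon> i *\<^sub>R e i) \<le> 2 * C * norm z"
    using dsum sub[of L] \<open>0 < r\<close> by simp
  have "norm (ind_vec e L) \<le> 2 * C * norm (\<Sum>i\<in>L. \<epsilon> i *\<^sub>R e i)"
    by (rule quasi_greedy_norm_ind_vec_le[OF assms(1) _ fin]) (fact C, simp add: \<epsilon>_def)
  then have "r * norm (ind_vec e L) \<le> 2 * C * (r * norm (\<Sum>i\<in>L. \<epsilon> i *\<^sub>R e i))"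
    using \<open>0 < r\<close> by (simp add: mult.left_commute[of _ r])
  also have "\<dots> \<le> 2 * C * (2 * C * norm z)"
    using signs \<open>0 \<le> C\<close> by (intro mult_left_mono) auto
  finally show ?thesis by (simp add: power2_eq_square)
qed

section \<open>Conservativeness and partial greediness with explicit constants\<close>

lemma w_conservativeE:
  assumes "w_conservative w e"
  obtains C where "1 \<le> C"
    and "\<And>A B. finite A \<Longrightarrow> finite B \<Longrightarrow> set_less A B \<Longrightarrow> weight w A \<le> weight w B \<Longrightarrow>
      norm (ind_vec e A) \<le> C * norm (ind_vec e B)"
  using assms unfolding w_conservative_def by blast

lemma w_partially_greedyE:
  assumes "w_partially_greedy w e"
  obtains C where "0 \<le> C"
    and "\<And>x L A. greedy_set e x (card L) L \<Longrightarrow> L \<noteq> {} \<Longrightarrow> finite A \<Longrightarrow>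
      weight w A \<le> weight w L \<Longrightarrow> set_less A {Min L} \<Longrightarrow>
      norm (x - basis_proj e L x) \<le> C * norm (x - basis_proj e A x)"
proof -
  let ?S = "\<lambda>L. {A. finite A \<and> weight w A \<le> weight w L \<and> set_less A {Min L}}"
  obtain C where C: "\<And>x m L. 1 \<le> m \<Longrightarrow> greedy_set e x m L \<Longrightarrow>
      norm (x - basis_proj e L x) \<le> C * (INF A\<in>?S L. norm (x - basis_proj e A x))"
    using assms unfolding w_partially_greedy_def by blast
  show ?thesis
  proof (rule that[of "max C 0"])
    fix x L A
    assume L: "greedy_set e x (card L) L" "L \<noteq> {}"
      and "finite A" "weight w A \<le> weight w L" "set_less A {Min L}"
    then have A: "A \<in> ?S L" by simp
    have "1 \<le> card L"
      using L by (simp add: greedy_set_def Suc_le_eq card_gt_0_iff)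
    then have "norm (x - basis_proj e L x) \<le> C * (INF A\<in>?S L. norm (x - basis_proj e A x))"
      using C L by blast
    \<comment> \<open>The infimum is nonnegative, so enlarging the constant is harmless; the new
      constant is nonnegative, so the infimum may then be replaced by the value at
      \<open>A\<close>.\<close>
    also have "\<dots> \<le> max C 0 * (INF A\<in>?S L. norm (x - basis_proj e A x))"
      by (intro mult_right_mono cINF_greatest) (use A in auto)
    also have "\<dots> \<le> max C 0 * norm (x - basis_proj e A x)"
      by (intro mult_left_mono cINF_lower[OF _ A] bdd_belowI2[where m = 0]) auto
    finally show "norm (x - basis_proj e L x) \<le> max C 0 * norm (x - basis_proj e A x)" .
  qed simp
qed

section \<open>Partial greediness implies quasi-greediness and conservativeness\<close>

lemma w_partially_greedy_imp_quasi_greedy: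
  assumes "weight_sequence w" and "w_partially_greedy w e"
  shows "quasi_greedy e"
proof -
  obtain C where C: "\<And>x L A. greedy_set e x (card L) L \<Longrightarrow> L \<noteq> {} \<Longrightarrow> finite A \<Longrightarrow>
      weight w A \<le> weight w L \<Longrightarrow> set_less A {Min L} \<Longrightarrow>
      norm (x - basis_proj e L x) \<le> C * norm (x - basis_proj e A x)"
    using w_partially_greedyE[OF assms(2)] by metis
  show ?thesis
    unfolding quasi_greedy_def
  \<comment> \<open>\<open>C\<close> bounds the remainder through the competitor \<open>{}\<close>;
    the triangle inequality adds 1 in passing from the remainder to the projection.\<close>
  proof (intro exI[of _ "1 + C"] allI impI)
    fix x m L
    assume "1 \<le> m" and "greedy_set e x m L"
    then have L: "greedy_set e x (card L) L" "L \<noteq> {}" by (auto simp: greedy_set_def)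
    have "weight w {} \<le> weight w L"
      using assms(1) by (simp add: weight_def weight_sequence_def sum_nonneg less_imp_le)
    then have "norm (x - basis_proj e L x) \<le> C * norm x"
      using C[OF L, of "{}"] by (simp add: basis_proj_def set_less_def)
    moreover have "norm (basis_proj e L x) \<le> norm x + norm (x - basis_proj e L x)"
      using norm_triangle_ineq4[of x "x - basis_proj e L x"] by simp
    ultimately show "norm (basis_proj e L x) \<le> (1 + C) * norm x"
      by (simp add: algebra_simps)
  qed
qed

lemma w_partially_greedy_imp_w_conservative:
  assumes "schauder_basis e" and "weight_sequence w" and "w_partially_greedy w e"
  shows "w_conservative w e"
proof -
  obtain C where C: "\<And>x L A. greedy_set e x (card L) L \<Longrightarrow> L \<noteq> {} \<Longrightarrow> finite A \<Longrightarrow>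
      weight w A \<le> weight w L \<Longrightarrow> set_less A {Min L} \<Longrightarrow>
      norm (x - basis_proj e L x) \<le> C * norm (x - basis_proj e A x)"
    using w_partially_greedyE[OF assms(3)] by metis
  show ?thesis
    unfolding w_conservative_def
  proof (intro exI[of _ "max C 1"] conjI allI impI)
    fix A B
    assume fin: "finite A" "finite B" and less: "set_less A B" and w: "weight w A \<le> weight w B"
    show "norm (ind_vec e A) \<le> max C 1 * norm (ind_vec e B)"
    proof (cases "B = {}")
      \<comment> \<open>An empty \<open>B\<close> cannot serve as a greedy set with
        \<open>1 \<le> m\<close>; positivity of the weights then forces \<open>A\<close> to be empty
        too.\<close>
      case True
      have "A = {}"
      proof (rule ccontr)
        assume "A \<noteq> {}"
        then have "0 < weight w A"
          using fin assms(2) unfolding weight_def weight_sequence_def by (intro sum_pos) auto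
        then show False using w True by (simp add: weight_def)
      qed
      then show ?thesis by (simp add: ind_vec_def)
    next
      case False
      define x where "x = ind_vec e (A \<union> B)"
      have disj: "A \<inter> B = {}" using less by (auto simp: set_less_def)
      have dual: "dual_fun e k x = (if k \<in> A \<union> B then 1 else 0)" for k
        unfolding x_def by (rule dual_fun_ind_vec) (use assms(1) fin in auto)
      have proj: "basis_proj e D x = ind_vec e D" if "D \<subseteq> A \<union> B" for D
        unfolding basis_proj_def ind_vec_def dual using that by (intro sum.cong) auto
      have x: "x = ind_vec e A + ind_vec e B"
        unfolding x_def ind_vec_def by (rule sum.union_disjoint[OF fin disj])
      \<comment> \<open>The coefficients of \<open>x\<close> on \<open>A \<union> B\<close> are all
        1, and ties may be broken in favour of \<open>B\<close>. Removing \<open>B\<close> from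
        \<open>x\<close> leaves \<open>ind_vec e A\<close>, and removing \<open>A\<close> leaves
        \<open>ind_vec e B\<close>.\<close>
      have "greedy_set e x (card B) B"
        using fin unfolding greedy_set_def dual by auto
      moreover have "set_less A {Min B}"
        using less fin False by (auto simp: set_less_def)
      ultimately have "norm (x - basis_proj e B x) \<le> C * norm (x - basis_proj e A x)"
        using C False fin w by blast
      then have "norm (ind_vec e A) \<le> C * norm (ind_vec e B)"
        using proj[of A] proj[of B] by (simp add: x)
      also have "\<dots> \<le> max C 1 * norm (ind_vec e B)" by (intro mult_right_mono) auto
      finally show ?thesis .
    qed
  qed simp
qed

section \<open>Quasi-greediness and conservativeness imply partial greediness\<close>

lemma quasi_greedy_w_conservative_imp_w_partially_greedy:
  assumes "schauder_basis e" and "quasi_greedy e" and "w_conservative w e"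
    and "weight_sequence w"
  shows "w_partially_greedy w e"
proof -
  obtain C where C0: "0 \<le> C"
    and C: "\<And>x L. greedy_set e x (card L) L \<Longrightarrow> norm (basis_proj e L x) \<le> C * norm x"
    using quasi_greedyE[OF assms(2)] by blast
  obtain K where K1: "1 \<le> K"
    and K: "\<And>A B. finite A \<Longrightarrow> finite B \<Longrightarrow> set_less A B \<Longrightarrow> weight w A \<le> weight w B \<Longrightarrow>
      norm (ind_vec e A) \<le> K * norm (ind_vec e B)"
    using w_conservativeE[OF assms(3)] by blast
  \<comment> \<open>\<open>1 + C\<close> pays for \<open>z - basis_proj e L z\<close>. The rest pays
    for \<open>basis_proj e A x\<close>: 2 from convexity, \<open>K\<close> from conservativeness,
    \<open>4 * C\<^sup>2\<close> from truncation.\<close>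
  define T where "T = 1 + C + 8 * K * C\<^sup>2"
  have "0 < T" using C0 K1 unfolding T_def by (simp add: add_pos_nonneg)
  have main: "norm (x - basis_proj e L x) \<le> T * norm (x - basis_proj e A x)"
    if L: "greedy_set e x (card L) L" "L \<noteq> {}"
      and A: "finite A" "weight w A \<le> weight w L" "set_less A {Min L}" for x L A
  proof -
    have finL: "finite L" using L(1) by (simp add: greedy_set_def)
    have less: "set_less A L"
      unfolding set_less_def using A(3) finL less_le_trans[OF _ Min_le[OF finL]]
      by (auto simp: set_less_def)
    then have disj: "A \<inter> L = {}" by (auto simp: set_less_def)
    define z where "z = x - basis_proj e A x"
    have dual_z: "dual_fun e k z = (if k \<in> A then 0 else dual_fun e k x)" for k
      unfolding z_def by (rule dual_fun_diff_basis_proj[OF assms(1) A(1)])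
    \<comment> \<open>Passing from \<open>x\<close> to \<open>z\<close> only annihilates
      coefficients outside \<open>L\<close>.\<close>
    have Lz: "greedy_set e z (card L) L"
      using L(1) disj unfolding greedy_set_def dual_z by (auto split: if_splits)
    have proj: "basis_proj e L z = basis_proj e L x"
      unfolding basis_proj_def dual_z using disj by (intro sum.cong) auto
    define r where "r = Min ((\<lambda>i. \<bar>dual_fun e i x\<bar>) ` L)"
    have "r \<in> (\<lambda>i. \<bar>dual_fun e i x\<bar>) ` L"
      unfolding r_def by (rule Min_in) (use finL L(2) in auto)
    then obtain j where j: "j \<in> L" "r = \<bar>dual_fun e j x\<bar>" by auto
    have r_le: "r \<le> \<bar>dual_fun e i z\<bar>" if "i \<in> L" for i
      unfolding r_def dual_z using that finL disj by auto
    \<comment> \<open>The minimum \<open>r\<close> is attained at \<open>j\<close> in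
      \<open>L\<close>, and greediness compares \<open>j\<close> with the indices of
      \<open>A\<close>, which lie outside \<open>L\<close>.\<close>
    have r_ge: "\<bar>dual_fun e i x\<bar> \<le> r" if "i \<in> A" for i
      using L(1) j that disj unfolding greedy_set_def by blast
    have trunc: "r * norm (ind_vec e L) \<le> 4 * C\<^sup>2 * norm z"
    \<comment> \<open>Truncation divides by moduli and so asks for \<open>0 < r\<close>; for
      \<open>r = 0\<close> the left side vanishes.\<close>
    proof (cases "r = 0")
      case False
      then have "0 < r" using j by auto
      show ?thesis
        by (rule quasi_greedy_truncation_le[OF assms(1) C0 _ Lz \<open>0 < r\<close> r_le]) (fact C)
    qed simp
    \<comment> \<open>Convexity needs all subsets of \<open>A\<close>; these inherit the position
      before \<open>L\<close> and, as weights are positive, the weight bound.\<close>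
    have "norm (sum e D) \<le> K * norm (ind_vec e L)" if D: "D \<subseteq> A" for D
    proof -
      have "weight w D \<le> weight w A"
        unfolding weight_def using assms(4) A(1) D
        by (intro sum_mono2) (auto simp: weight_sequence_def less_imp_le)
      moreover have "set_less D L" using less D by (auto simp: set_less_def)
      ultimately show ?thesis
        using K[OF finite_subset[OF D A(1)] finL] A(2) by (simp add: ind_vec_def)
    qed
    then have "norm (basis_proj e A x) \<le> 2 * (r * (K * norm (ind_vec e L)))"
      unfolding basis_proj_def
      by (intro norm_sum_bounded_coeffs_le[OF A(1)]) (use r_ge j in auto)
    also have "\<dots> = 2 * K * (r * norm (ind_vec e L))" by simp
    also have "\<dots> \<le> 2 * K * (4 * C\<^sup>2 * norm z)"
      using trunc K1 by (intro mult_left_mono) auto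
    finally have PA: "norm (basis_proj e A x) \<le> 8 * K * C\<^sup>2 * norm z" by simp
    have "x - basis_proj e L x = (z - basis_proj e L z) + basis_proj e A x"
      unfolding proj by (simp add: z_def)
    also have "norm \<dots> \<le> norm z + norm (basis_proj e L z) + norm (basis_proj e A x)"
      by (intro norm_triangle_mono norm_triangle_ineq4 order_refl)
    also have "\<dots> \<le> norm z + C * norm z + 8 * K * C\<^sup>2 * norm z"
      using C[OF Lz] PA by simp
    also have "\<dots> = T * norm z" by (simp add: T_def algebra_simps)
    finally show ?thesis unfolding z_def .
  qed
  show ?thesis
    unfolding w_partially_greedy_def
  proof (intro exI[of _ T] allI impI)
    fix x m L
    assume "1 \<le> m" and "greedy_set e x m L"
    then have L: "greedy_set e x (card L) L" "L \<noteq> {}" by (auto simp: greedy_set_def)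
    let ?S = "{A. finite A \<and> weight w A \<le> weight w L \<and> set_less A {Min L}}"
    have "{} \<in> ?S"
      using assms(4)
      by (simp add: weight_def weight_sequence_def set_less_def sum_nonneg less_imp_le)
    \<comment> \<open>After division by \<open>T\<close> the estimate for each competitor says that
      the left side is a lower bound of a nonempty set of norms.\<close>
    then have "norm (x - basis_proj e L x) / T \<le> (INF A\<in>?S. norm (x - basis_proj e A x))"
      using main[OF L] \<open>0 < T\<close>
      by (intro cINF_greatest) (auto simp: pos_divide_le_eq mult.commute)
    then show "norm (x - basis_proj e L x) \<le> T * (INF A\<in>?S. norm (x - basis_proj e A x))"
      using \<open>0 < T\<close> by (simp add: pos_divide_le_eq mult.commute)
  qed
qed

theorem theorem2p1:
  fixes e :: "nat \<Rightarrow> 'a::banach" and w :: "nat \<Rightarrow> real"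
  assumes "schauder_basis e" and "\<forall>n. norm (e n) = 1" and "weight_sequence w"
  shows "w_partially_greedy w e \<longleftrightarrow> quasi_greedy e \<and> w_conservative w e"
  using w_partially_greedy_imp_quasi_greedy w_partially_greedy_imp_w_conservative
    quasi_greedy_w_conservative_imp_w_partially_greedy assms by blast

end
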